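(* Let $n\ge 1$, let $A,B$ be positive semidefinite $n\times n$ complex matrices, and let $f:[0,\infty)\to[0,\infty)$ be a concave function. Then for every symmetric norm $\|\cdot\|$ on the space of $n\times n$ complex matrices, $$\| f(A+B)\| \le \| f(A)+f(B)\|.$$
   Context: A symmetric (or unitarily invariant) norm $\|\cdot\|$ on the $n\times n$ complex matrices is a norm such that $\|A\|=\|UAV\|$ for all matrices $A$ and all unitary matrices $U,V$. For a positive semidefinite matrix $A$, $f(A)$ is defined by the usual functional calculus (apply $f$ to the eigenvalues in a spectral decomposition). *)

theory Defs
  imports "HOL-Analysis.Analysis"
begin

definition adjoint_matrix :: "complex ^ 'n ^ 'm \<Rightarrow> complex ^ 'm ^ 'n" where
  "adjoint_matrix A = (\<chi> i j. cnj (A $ j $ i))"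

definition unitary_matrix :: "complex ^ 'n ^ 'n \<Rightarrow> bool" where
  "unitary_matrix U \<longleftrightarrow>
     adjoint_matrix U ** U = mat 1 \<and> U ** adjoint_matrix U = mat 1"

definition hermitian_matrix :: "complex ^ 'n ^ 'n \<Rightarrow> bool" where
  "hermitian_matrix A \<longleftrightarrow> adjoint_matrix A = A"

text \<open>For Hermitian \<open>A\<close> the form \<open>x\<^sup>* A x\<close> is real, so taking the real part loses nothing.\<close>

definition positive_semidefinite :: "complex ^ 'n ^ 'n \<Rightarrow> bool" where
  "positive_semidefinite A \<longleftrightarrow>
     hermitian_matrix A \<and>
     (\<forall>x :: complex ^ 'n. 0 \<le> Re (\<Sum>i\<in>UNIV. cnj (x $ i) * (A *v x) $ i))"

definition diag_matrix :: "('n \<Rightarrow> real) \<Rightarrow> complex ^ 'n ^ 'n" where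
  "diag_matrix d = (\<chi> i j. if i = j then complex_of_real (d i) else 0)"

text \<open>\<open>spectral_decomposition A U d\<close> says that \<open>A = U diag(d) U\<^sup>*\<close> with \<open>U\<close> unitary and \<open>d\<close> real.\<close>

definition spectral_decomposition ::
    "complex ^ 'n ^ 'n \<Rightarrow> complex ^ 'n ^ 'n \<Rightarrow> ('n \<Rightarrow> real) \<Rightarrow> bool" where
  "spectral_decomposition A U d \<longleftrightarrow>
     unitary_matrix U \<and> A = U ** diag_matrix d ** adjoint_matrix U"

text \<open>\<open>f(A) = U diag(f \<circ> d) U\<^sup>*\<close>. The result does not depend on the decomposition chosen, see
  \<open>matrix_fun_eq\<close> below; it is meaningful exactly for Hermitian \<open>A\<close>, and for positive
  semidefinite \<open>A\<close> it only uses the values of \<open>f\<close> on \<open>[0, \<infinity>)\<close>.\<close>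

definition matrix_fun :: "(real \<Rightarrow> real) \<Rightarrow> complex ^ 'n ^ 'n \<Rightarrow> complex ^ 'n ^ 'n" where
  "matrix_fun f A =
     (THE X. \<exists>U d. spectral_decomposition A U d \<and>
                   X = U ** diag_matrix (\<lambda>i. f (d i)) ** adjoint_matrix U)"

definition matrix_norm :: "(complex ^ 'n ^ 'n \<Rightarrow> real) \<Rightarrow> bool" where
  "matrix_norm N \<longleftrightarrow>
     (\<forall>X. 0 \<le> N X) \<and>
     (\<forall>X. N X = 0 \<longleftrightarrow> X = 0) \<and>
     (\<forall>c X. N (\<chi> i j. c * X $ i $ j) = cmod c * N X) \<and>
     (\<forall>X Y. N (X + Y) \<le> N X + N Y)"

definition symmetric_norm :: "(complex ^ 'n ^ 'n \<Rightarrow> real) \<Rightarrow> bool" where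
  "symmetric_norm N \<longleftrightarrow>
     matrix_norm N \<and>
     (\<forall>X U V. unitary_matrix U \<and> unitary_matrix V \<longrightarrow> N (U ** X ** V) = N X)"

lemma diag_matrix_mult_right: "(W ** diag_matrix d) $ i $ j = W $ i $ j * complex_of_real (d j)"
  by (simp add: matrix_matrix_mult_def diag_matrix_def if_distrib sum.If_cases cong: if_cong)

lemma diag_matrix_mult_left: "(diag_matrix d ** W) $ i $ j = complex_of_real (d i) * W $ i $ j"
proof -
  have "(diag_matrix d ** W) $ i $ j =
      (\<Sum>k\<in>UNIV. if i = k then complex_of_real (d i) * W $ k $ j else 0)"
    unfolding matrix_matrix_mult_def diag_matrix_def
    by (simp only: vec_lambda_beta, rule sum.cong, auto)
  then show ?thesis by simp
qed

lemma matrix_fun_unique: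
  assumes "spectral_decomposition A U d" "spectral_decomposition A V e"
  shows "U ** diag_matrix (\<lambda>i. f (d i)) ** adjoint_matrix U =
         V ** diag_matrix (\<lambda>i. f (e i)) ** adjoint_matrix V"
proof -
  define W where "W = adjoint_matrix V ** U"
  have U: "adjoint_matrix U ** U = mat 1" "U ** adjoint_matrix U = mat 1"
    and V: "adjoint_matrix V ** V = mat 1" "V ** adjoint_matrix V = mat 1"
    and A: "U ** diag_matrix d ** adjoint_matrix U = V ** diag_matrix e ** adjoint_matrix V"
    using assms by (auto simp: spectral_decomposition_def unitary_matrix_def)
  have "W ** diag_matrix d
      = adjoint_matrix V ** (U ** diag_matrix d ** adjoint_matrix U) ** U"
    unfolding W_def by (metis U(1) matrix_mul_assoc matrix_mul_rid)
  also have "\<dots> = diag_matrix e ** W"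
    unfolding A W_def by (metis V(1) matrix_mul_assoc matrix_mul_lid)
  finally have eq: "W ** diag_matrix d = diag_matrix e ** W" .
  have "W $ i $ j * complex_of_real (f (d j)) = complex_of_real (f (e i)) * W $ i $ j" for i j
  proof -
    have "W $ i $ j * complex_of_real (d j) = complex_of_real (e i) * W $ i $ j"
      using eq by (metis diag_matrix_mult_left diag_matrix_mult_right)
    then have "W $ i $ j = 0 \<or> d j = e i" by (simp add: mult.commute)
    then show ?thesis by auto
  qed
  then have "W ** diag_matrix (\<lambda>i. f (d i)) = diag_matrix (\<lambda>i. f (e i)) ** W"
    by (simp add: vec_eq_iff diag_matrix_mult_left diag_matrix_mult_right)
  then have "V ** (W ** diag_matrix (\<lambda>i. f (d i))) ** adjoint_matrix U
      = V ** (diag_matrix (\<lambda>i. f (e i)) ** W) ** adjoint_matrix U" by simp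
  moreover have "V ** (W ** diag_matrix (\<lambda>i. f (d i))) = U ** diag_matrix (\<lambda>i. f (d i))"
    unfolding W_def by (metis V(2) matrix_mul_assoc matrix_mul_lid)
  moreover have "V ** (diag_matrix (\<lambda>i. f (e i)) ** W) ** adjoint_matrix U
      = V ** diag_matrix (\<lambda>i. f (e i)) ** adjoint_matrix V"
    unfolding W_def by (metis U(2) matrix_mul_assoc matrix_mul_rid)
  ultimately show ?thesis by simp
qed

lemma matrix_fun_eq:
  assumes "spectral_decomposition A U d"
  shows "matrix_fun f A = U ** diag_matrix (\<lambda>i. f (d i)) ** adjoint_matrix U"
  unfolding matrix_fun_def
  by (rule the_equality) (use assms matrix_fun_unique in blast)+

end

theory Submission
  imports Defs "HOL-Combinatorics.Transposition"
begin

text \<open>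
  Write \<open>C = A + B\<close> and pass to an orthonormal eigenbasis \<open>x\<^sub>j\<close> of \<open>C\<close>, with eigenvalues \<open>c\<^sub>j\<close>.
  There \<open>f(C)\<close> is the diagonal matrix of the numbers \<open>f(c\<^sub>j)\<close>. Let \<open>m\<^sub>j\<close> be the diagonal entries
  of \<open>f(A) + f(B)\<close> in the same basis. Averaging over sign changes of the basis shows that
  replacing a matrix by its diagonal part does not increase a symmetric norm
  (\<open>symmetric_norm_pinching\<close>), so it suffices to compare two diagonal matrices. On these a
  symmetric norm is a convex function invariant under permutations and sign changes, and the
  comparison holds as soon as \<open>f(c)\<close> is weakly majorized by \<open>m\<close>
  (\<open>symmetric_norm_diag_weak_majorization\<close>).

  The majorization needed is \<open>\<Sum>j\<in>K. f(c\<^sub>j) \<le> \<Sum>j\<in>K. m\<^sub>j\<close> for every set \<open>K\<close> of indices of largest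
  eigenvalues, and this has a short proof (\<open>concave_sum_weak_majorization\<close>). Let \<open>v\<close> be a unit
  eigenvector of \<open>A\<close> with eigenvalue \<open>a > 0\<close>, and put \<open>p\<^sub>j = |\<langle>v, x\<^sub>j\<rangle>|\<^sup>2\<close>. From \<open>A \<le> C\<close> one gets
  \<open>a \<cdot> \<Sum>j. p\<^sub>j / c\<^sub>j \<le> 1\<close>, that is, \<open>\<Sum>j. p\<^sub>j (1 - a / c\<^sub>j) \<ge> 0\<close>. The factor \<open>1 - a / c\<^sub>j\<close> grows
  with \<open>c\<^sub>j\<close>, so the partial sum over the largest eigenvalues is nonnegative too. A supporting line
  of \<open>f\<close> at \<open>a\<close> bounds \<open>f(a) - a f(c\<^sub>j) / c\<^sub>j\<close> from below by a nonnegative multiple of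
  \<open>1 - a / c\<^sub>j\<close>. Hence \<open>\<Sum>j\<in>K. p\<^sub>j a f(c\<^sub>j) / c\<^sub>j \<le> \<Sum>j\<in>K. p\<^sub>j f(a)\<close>. Summing over the eigenvectors
  of \<open>A\<close>, doing the same for \<open>B\<close>, and adding, the left-hand sides combine to \<open>\<Sum>j\<in>K. f(c\<^sub>j)\<close>,
  because \<open>\<langle>x\<^sub>j, (A + B) x\<^sub>j\<rangle> = c\<^sub>j\<close>, and the right-hand sides combine to \<open>\<Sum>j\<in>K. m\<^sub>j\<close>. The indices with
  \<open>c\<^sub>j = 0\<close> are treated separately, using that \<open>f\<close> is monotone.
\<close>

section \<open>Adjoints and unitary matrices\<close>

lemma adjoint_matrix_adjoint [simp]: "adjoint_matrix (adjoint_matrix A) = A"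
  by (simp add: adjoint_matrix_def vec_eq_iff)

lemma adjoint_matrix_mult: "adjoint_matrix (A ** B) = adjoint_matrix B ** adjoint_matrix A"
  by (simp add: adjoint_matrix_def matrix_matrix_mult_def vec_eq_iff mult.commute)

lemma adjoint_diag_matrix [simp]: "adjoint_matrix (diag_matrix d) = diag_matrix d"
  by (simp add: adjoint_matrix_def diag_matrix_def vec_eq_iff)

lemma unitary_matrix_mult:
  assumes "unitary_matrix U" "unitary_matrix V"
  shows "unitary_matrix (U ** V)"
proof -
  have "adjoint_matrix V ** (adjoint_matrix U ** U) ** V = mat 1"
       "U ** (V ** adjoint_matrix V) ** adjoint_matrix U = mat 1"
    using assms by (simp_all add: unitary_matrix_def matrix_mul_lid matrix_mul_rid)
  then show ?thesis
    by (simp add: unitary_matrix_def adjoint_matrix_mult matrix_mul_assoc)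
qed

lemma unitary_matrix_adjoint: "unitary_matrix U \<Longrightarrow> unitary_matrix (adjoint_matrix U)"
  by (simp add: unitary_matrix_def)

lemma unitary_matrix_adjointI:
  assumes "adjoint_matrix U ** U = mat 1"
  shows "unitary_matrix U"
  using assms matrix_left_right_inverse by (auto simp: unitary_matrix_def)

lemma unitary_matrix_col_sum:
  assumes "unitary_matrix W"
  shows "(\<Sum>i\<in>UNIV. (cmod (W $ i $ j))\<^sup>2) = 1"
proof -
  have "complex_of_real (\<Sum>i\<in>UNIV. (cmod (W $ i $ j))\<^sup>2) = (adjoint_matrix W ** W) $ j $ j"
    by (simp add: matrix_matrix_mult_def adjoint_matrix_def complex_norm_square mult.commute
        del: of_real_power)
  also have "\<dots> = 1" using assms by (simp add: unitary_matrix_def mat_def)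
  finally show ?thesis using of_real_eq_1_iff by blast
qed

lemma unitary_matrix_row_sum:
  assumes "unitary_matrix W"
  shows "(\<Sum>j\<in>UNIV. (cmod (W $ i $ j))\<^sup>2) = 1"
  using unitary_matrix_col_sum[OF unitary_matrix_adjoint[OF assms], of i]
  by (simp add: adjoint_matrix_def)

lemma matrix_mult_add_rdistrib: "(A + B) ** C = A ** C + B ** C" for A B C :: "complex ^ 'n ^ 'n"
  by (simp add: matrix_matrix_mult_def vec_eq_iff distrib_right sum.distrib)

section \<open>The spectral theorem for Hermitian matrices\<close>

text \<open>
  Orthonormality of eigenvectors refers to this complex form; its real part is the inner product of
  the real Euclidean space underlying \<open>complex ^ 'n\<close>, through which compactness and dimension
  arguments become available.
\<close>

definition cinner :: "complex ^ 'n \<Rightarrow> complex ^ 'n \<Rightarrow> complex" where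
  "cinner x y = (\<Sum>i\<in>UNIV. cnj (x $ i) * y $ i)"

lemma cinner_add_right: "cinner x (y + z) = cinner x y + cinner x z"
  by (simp add: cinner_def algebra_simps sum.distrib)

lemma cinner_scaleR_right: "cinner x (r *\<^sub>R y) = of_real r * cinner x y"
  by (simp add: cinner_def sum_distrib_left algebra_simps scaleR_conv_of_real[of _ "_ :: complex"])

lemma cinner_commute: "cinner y x = cnj (cinner x y)"
  by (simp add: cinner_def mult.commute)

lemma Re_cinner: "Re (cinner x y) = x \<bullet> y"
  by (simp add: cinner_def inner_vec_def inner_complex_def)

lemma cinner_self: "cinner x x = of_real ((norm x)\<^sup>2)"
proof (rule complex_eqI)
  show "Re (cinner x x) = Re (of_real ((norm x)\<^sup>2))"
    by (simp only: Re_cinner Re_complex_of_real power2_norm_eq_inner)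
  show "Im (cinner x x) = Im (of_real ((norm x)\<^sup>2))"
    by (simp add: cinner_def)
qed

lemma cinner_adjoint: "cinner x (A *v y) = cinner (adjoint_matrix A *v x) y"
proof -
  have "cinner x (A *v y) = (\<Sum>i\<in>UNIV. \<Sum>j\<in>UNIV. cnj (x $ i) * (A $ i $ j * y $ j))"
    by (simp add: cinner_def matrix_vector_mult_def sum_distrib_left)
  also have "\<dots> = (\<Sum>j\<in>UNIV. \<Sum>i\<in>UNIV. cnj (x $ i) * (A $ i $ j * y $ j))"
    by (rule sum.swap)
  also have "\<dots> = cinner (adjoint_matrix A *v x) y"
    by (simp add: cinner_def matrix_vector_mult_def adjoint_matrix_def sum_distrib_right
        sum_distrib_left algebra_simps)
  finally show ?thesis .
qed

lemma inner_hermitian: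
  assumes "hermitian_matrix A"
  shows "x \<bullet> (A *v y) = (A *v x) \<bullet> y"
  using assms cinner_adjoint[of x A y] unfolding hermitian_matrix_def
  by (metis Re_cinner)

lemma linear_cinner: "linear (cinner x)"
  by (rule linearI) (simp_all add: cinner_add_right cinner_scaleR_right
      scaleR_conv_of_real[of _ "_ :: complex"])

lemma linear_matrix_vector: "linear ((*v) (A :: complex ^ 'n ^ 'm))"
  using matrix_vector_mul_bounded_linear by (rule bounded_linear.linear)

text \<open>
  Indexing the family by a proper subset of the coordinates turns the dimension count into one
  statement: the linear map sending \<open>x\<close> to the coefficients \<open>\<langle>u\<^sub>s, x\<rangle>\<close>, padded by zeros, misses the
  \<open>k\<close>-th unit vector, so it is not onto and therefore not injective.
\<close>

lemma orthogonal_vector_exists: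
  fixes u :: "'n \<Rightarrow> complex ^ 'n"
  assumes "k \<notin> S"
  shows "\<exists>x. norm x = 1 \<and> (\<forall>s\<in>S. cinner (u s) x = 0)"
proof -
  define T :: "complex ^ 'n \<Rightarrow> complex ^ 'n" where "T x = (\<chi> s. if s \<in> S then cinner (u s) x else 0)" for x
  have lin: "linear T"
    by (rule linearI) (simp_all add: T_def vec_eq_iff cinner_add_right cinner_scaleR_right
      scaleR_conv_of_real[of _ "_ :: complex"])
  have "axis k 1 \<notin> range T"
  proof
    assume "axis k 1 \<in> range T"
    then obtain x where "T x = axis k 1" by auto
    then have "T x $ k = 1" by simp
    then show False using assms by (simp add: T_def)
  qed
  then have "\<not> surj T" by auto
  then have "\<not> inj T" using lin linear_injective_imp_surjective by blast
  then obtain x where x: "T x = 0" "x \<noteq> 0"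
    using lin linear_injective_0 by blast
  have "T (x /\<^sub>R norm x) = 0"
    using x lin by (simp add: linear_cmul)
  then have "\<forall>s\<in>S. cinner (u s) (x /\<^sub>R norm x) = 0"
    unfolding T_def vec_eq_iff vec_lambda_beta zero_index by metis
  moreover have "norm (x /\<^sub>R norm x) = 1" using x by simp
  ultimately show ?thesis by blast
qed

text \<open>
  The orthogonal complement of a family of eigenvectors is invariant, and the quadratic form
  \<open>\<langle>x, A x\<rangle>\<close> attains its maximum on the unit sphere of that complement. A maximizer is an
  eigenvector.
\<close>

lemma hermitian_eigenvector_in_complement:
  fixes A :: "complex ^ 'n ^ 'n" and S :: "'n set"
  assumes herm: "hermitian_matrix A"
    and eig: "\<And>s. s \<in> S \<Longrightarrow> A *v u s = d s *\<^sub>R u s"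
    and k: "k \<notin> S"
  shows "\<exists>x e. norm x = 1 \<and> (\<forall>s\<in>S. cinner (u s) x = 0) \<and> A *v x = e *\<^sub>R x"
proof -
  define W where "W = {x. \<forall>s\<in>S. cinner (u s) x = 0}"
  define q where "q x = x \<bullet> (A *v x)" for x
  have W_eq: "W = (\<Inter>s\<in>S. (\<lambda>x. cinner (u s) x) -` {0})" by (auto simp: W_def)
  have contc: "continuous_on UNIV (\<lambda>x. cinner (u s) x)" for s
    using linear_cinner linear_continuous_on linear_conv_bounded_linear by blast
  have clW: "closed W"
    unfolding W_eq by (intro closed_INT ballI closed_vimage closed_singleton contc)
  have subW: "subspace W"
    unfolding W_def subspace_def by (auto simp: cinner_add_right cinner_scaleR_right)
       (simp add: cinner_def)
  have inv: "A *v x \<in> W" if "x \<in> W" for x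
  proof -
    have "cinner (u s) (A *v x) = cinner (d s *\<^sub>R u s) x" if "s \<in> S" for s
      using cinner_adjoint[of "u s" A x] herm eig[OF that] by (simp add: hermitian_matrix_def)
    then show ?thesis using \<open>x \<in> W\<close> unfolding W_def
      by simp (metis cinner_commute cinner_scaleR_right complex_cnj_zero mult_zero_right)
  qed
  have "compact (sphere 0 1 \<inter> W)" using clW by (intro compact_Int_closed) auto
  moreover have "sphere 0 1 \<inter> W \<noteq> {}"
    using orthogonal_vector_exists[OF k, of u] by (auto simp: W_def)
  moreover have "continuous_on (sphere 0 1 \<inter> W) q"
    unfolding q_def using linear_matrix_vector[of A]
    by (intro continuous_intros linear_continuous_on linear_conv_bounded_linear[THEN iffD1])
  ultimately obtain x where x: "norm x = 1" "x \<in> W" and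
      max: "\<And>y. norm y = 1 \<Longrightarrow> y \<in> W \<Longrightarrow> q y \<le> q x"
    using continuous_attains_sup[of "sphere 0 1 \<inter> W" q]
    by (metis IntE IntI mem_sphere_0)
  define e where "e = q x"
  define r where "r z = e * (z \<bullet> z) - q z" for z
  have r_nonneg: "r z \<ge> 0" if "z \<in> W" for z
  proof (cases "z = 0")
    case False
    define y where "y = z /\<^sub>R norm z"
    have z: "z = norm z *\<^sub>R y" "norm y = 1" using False by (simp_all add: y_def)
    have "y \<in> W" using subW that by (simp add: y_def subspace_scale)
    then have "q y \<le> e" using max z by (simp add: e_def)
    moreover have "q z = (norm z)\<^sup>2 * q y"
      using z(1) linear_matrix_vector[of A]
      by (metis (no_types, lifting) inner_scaleR_left inner_scaleR_right linear_cmul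
          power2_eq_square mult.assoc q_def)
    moreover have "z \<bullet> z = (norm z)\<^sup>2" by (simp add: power2_norm_eq_inner)
    ultimately show ?thesis
      unfolding r_def by (simp add: mult.commute[of e] mult_left_mono)
  qed (simp add: r_def q_def)
  have r_x: "r x = 0" using x by (simp add: r_def e_def flip: power2_norm_eq_inner)
  \<comment> \<open>The maximum is stationary in the direction of the residual, which therefore vanishes.\<close>
  define y where "y = e *\<^sub>R x - A *v x"
  have yW: "y \<in> W" using subW inv x by (simp add: y_def subspace_diff subspace_scale)
  have expand: "r (x + t *\<^sub>R y) = 2 * t * (y \<bullet> y) + t\<^sup>2 * r y" for t
  proof -
    have lin: "A *v (x + t *\<^sub>R y) = A *v x + t *\<^sub>R (A *v y)"
      using linear_matrix_vector[of A] by (simp add: linear_add linear_cmul)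
    have "r (x + t *\<^sub>R y) = r x + 2 * t * (e * (x \<bullet> y) - (A *v x) \<bullet> y) + t\<^sup>2 * r y"
      unfolding r_def q_def lin
      using inner_hermitian[OF herm, of x y] 
      by (simp add: inner_add_left inner_add_right inner_commute algebra_simps power2_eq_square)
    moreover have "y \<bullet> y = e * (x \<bullet> y) - (A *v x) \<bullet> y"
      by (subst (1) y_def) (simp add: inner_diff_left)
    ultimately show ?thesis using r_x by simp
  qed
  \<comment> \<open>The expansion has nonnegative values for all \<open>t\<close>. A slightly negative \<open>t\<close>, small enough that
     the linear term outweighs the quadratic one, forces \<open>y = 0\<close>.\<close>
  have "y \<bullet> y = 0"
  proof (rule ccontr)
    assume "y \<bullet> y \<noteq> 0"
    then have pos: "y \<bullet> y > 0" by (simp add: order_less_le)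
    have ry: "r y \<ge> 0" using r_nonneg yW .
    define t where "t = - (y \<bullet> y) / (r y + 1)"
    have tneg: "t < 0" using pos ry by (simp add: t_def divide_neg_pos)
    have "0 \<le> r (x + t *\<^sub>R y)"
      using subW x yW by (intro r_nonneg) (simp add: subspace_add subspace_scale)
    then have "0 \<le> t * (2 * (y \<bullet> y) + t * r y)"
      unfolding expand by (simp add: algebra_simps power2_eq_square)
    then have "2 * (y \<bullet> y) + t * r y \<le> 0"
      using tneg by (simp add: zero_le_mult_iff)
    moreover have "t * r y \<ge> - (y \<bullet> y)"
      using pos ry by (simp add: t_def field_simps)
    ultimately show False using pos by linarith
  qed
  then have "A *v x = e *\<^sub>R x" by (simp add: y_def)
  then show ?thesis using x by (auto simp: W_def)
qed

lemma hermitian_orthonormal_eigenfamily: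
  fixes A :: "complex ^ 'n ^ 'n" and S :: "'n set"
  assumes herm: "hermitian_matrix A" and "finite S"
  shows "\<exists>u d. (\<forall>s\<in>S. A *v u s = d s *\<^sub>R u s) \<and>
      (\<forall>s\<in>S. \<forall>t\<in>S. cinner (u s) (u t) = (if s = t then 1 else 0))"
  using \<open>finite S\<close>
proof (induction S)
  case empty
  then show ?case by simp
next
  case (insert k S)
  then obtain u d where ud: "\<And>s. s \<in> S \<Longrightarrow> A *v u s = d s *\<^sub>R u s"
    "\<And>s t. s \<in> S \<Longrightarrow> t \<in> S \<Longrightarrow> cinner (u s) (u t) = (if s = t then 1 else 0)" by blast
  obtain x e where x: "norm x = 1" "\<And>s. s \<in> S \<Longrightarrow> cinner (u s) x = 0" "A *v x = e *\<^sub>R x"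
    using hermitian_eigenvector_in_complement[OF herm, of S u d k] ud(1) insert.hyps by metis
  have "cinner x x = 1" using x(1) by (simp add: cinner_self)
  moreover have "cinner x (u s) = 0" if "s \<in> S" for s
    using x(2)[OF that] cinner_commute[of x "u s"] by simp
  ultimately show ?case
    using ud x insert.hyps
    by (intro exI[of _ "u(k := x)"] exI[of _ "d(k := e)"]) auto
qed

theorem hermitian_spectral_decomposition:
  fixes A :: "complex ^ 'n ^ 'n"
  assumes "hermitian_matrix A"
  shows "\<exists>U d. spectral_decomposition A U d"
proof -
  obtain u :: "'n \<Rightarrow> complex ^ 'n" and d where eig: "\<And>s. A *v u s = d s *\<^sub>R u s"
    and on: "\<And>s t. cinner (u s) (u t) = (if s = t then 1 else 0)"
    using hermitian_orthonormal_eigenfamily[OF assms finite_class.finite_UNIV] by (metis UNIV_I)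
  define U :: "complex ^ 'n ^ 'n" where "U = (\<chi> i s. u s $ i)"
  have "adjoint_matrix U ** U = mat 1"
    using on by (simp add: vec_eq_iff U_def adjoint_matrix_def matrix_matrix_mult_def mat_def cinner_def)
  then have U: "unitary_matrix U" by (rule unitary_matrix_adjointI)
  have "(A ** U) $ i $ s = (U ** diag_matrix d) $ i $ s" for i s
  proof -
    have "(A ** U) $ i $ s = (A *v u s) $ i"
      by (simp add: U_def matrix_matrix_mult_def matrix_vector_mult_def)
    then show ?thesis
      by (simp add: eig diag_matrix_mult_right U_def mult.commute
          scaleR_conv_of_real[of _ "_ :: complex"])
  qed
  then have "A ** U = U ** diag_matrix d" by (simp add: vec_eq_iff)
  then have "A = U ** diag_matrix d ** adjoint_matrix U"
    using U by (metis matrix_mul_assoc matrix_mul_rid unitary_matrix_def)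
  then show ?thesis using U by (auto simp: spectral_decomposition_def)
qed

section \<open>Quadratic forms and positive semidefiniteness\<close>

text \<open>
  The quadratic form of \<open>W\<^sup>* diag(a) W\<close> is a combination of squares. Together with the next lemma,
  which reads off the diagonal of such a matrix, this turns statements about the matrices \<open>A\<close>,
  \<open>B\<close>, \<open>f(A)\<close> and \<open>f(B)\<close>, written in the eigenbasis of \<open>A + B\<close>, into statements about real sums
  with weights \<open>|W\<^sub>i\<^sub>j|\<^sup>2\<close>.
\<close>

lemma cinner_conj_diag:
  "cinner x ((adjoint_matrix W ** diag_matrix a ** W) *v x)
    = of_real (\<Sum>l\<in>UNIV. a l * (cmod ((W *v x) $ l))\<^sup>2)"
proof -
  have "cinner x ((adjoint_matrix W ** diag_matrix a ** W) *v x)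
      = cinner (W *v x) (diag_matrix a *v (W *v x))"
    by (simp add: cinner_adjoint flip: matrix_vector_mul_assoc)
  moreover have "(diag_matrix a *v z) $ l = of_real (a l) * z $ l" for z l
  proof -
    have "(diag_matrix a *v z) $ l = (\<Sum>k\<in>UNIV. if l = k then of_real (a l) * z $ l else 0)"
      unfolding matrix_vector_mult_def diag_matrix_def by (simp only: vec_lambda_beta, rule sum.cong) auto
    then show ?thesis by simp
  qed
  ultimately show ?thesis
    by (simp add: cinner_def complex_norm_square[symmetric] mult.left_commute mult.commute
        del: of_real_power of_real_mult)
       (simp add: complex_norm_square mult_ac)
qed

lemma conj_diag_diagonal_entry:
  "(adjoint_matrix W ** diag_matrix a ** W) $ j $ j
    = complex_of_real (\<Sum>i\<in>UNIV. (cmod (W $ i $ j))\<^sup>2 * a i)"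
  unfolding matrix_matrix_mult_def[of "adjoint_matrix W ** diag_matrix a"]
  by (simp add: diag_matrix_mult_right adjoint_matrix_def complex_norm_square mult_ac
      del: of_real_power)

lemma positive_semidefinite_eigenvalue_nonneg:
  assumes psd: "positive_semidefinite A" and dec: "spectral_decomposition A U d"
  shows "0 \<le> d i"
proof -
  define x where "x = U *v axis i 1"
  have "adjoint_matrix U *v x = axis i 1"
    using dec by (simp add: x_def matrix_vector_mul_assoc spectral_decomposition_def unitary_matrix_def)
  moreover have "A = adjoint_matrix (adjoint_matrix U) ** diag_matrix d ** adjoint_matrix U"
    using dec by (simp add: spectral_decomposition_def)
  ultimately have "cinner x (A *v x) = of_real (\<Sum>l\<in>UNIV. d l * (cmod (axis i 1 $ l))\<^sup>2)"
    using cinner_conj_diag[of x "adjoint_matrix U" d] by simp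
  also have "(\<Sum>l\<in>UNIV. d l * (cmod (axis i 1 $ l))\<^sup>2) = (\<Sum>l\<in>UNIV. if l = i then d i else 0)"
    by (rule sum.cong) (auto simp: axis_def)
  finally have "Re (cinner x (A *v x)) = d i" by simp
  then show ?thesis using psd by (metis positive_semidefinite_def cinner_def)
qed

lemma positive_semidefinite_add:
  assumes "positive_semidefinite A" "positive_semidefinite B"
  shows "positive_semidefinite (A + B)"
proof -
  have "hermitian_matrix (A + B)"
    using assms by (simp add: positive_semidefinite_def hermitian_matrix_def adjoint_matrix_def vec_eq_iff)
  moreover have "0 \<le> Re (cinner x ((A + B) *v x))" for x
    using assms by (simp add: positive_semidefinite_def matrix_vector_mult_add_rdistrib
        cinner_add_right flip: cinner_def)
  ultimately show ?thesis by (simp add: positive_semidefinite_def cinner_def)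
qed

section \<open>Concave functions and sums over upper sets\<close>

lemma concave_supporting_line:
  fixes f :: "real \<Rightarrow> real"
  assumes conc: "concave_on {0..} f" and "0 < a"
  obtains m where "\<And>t. 0 \<le> t \<Longrightarrow> f t \<le> f a + m * (t - a)"
proof -
  \<comment> \<open>A subgradient at \<open>a\<close> of the convex function \<open>- f\<close>.\<close>
  define D where "D = Inf ((\<lambda>t. (- f a - - f t) / (a - t)) ` ({a<..} \<inter> {0..}))"
  have "- f t \<ge> - f a + D * (t - a)" if "0 \<le> t" for t
    unfolding D_def using conc \<open>0 < a\<close> that
    by (intro convex_le_Inf_differential) (auto simp: concave_on_def interior_real_atLeast)
  then show thesis by (intro that[of "- D"]) fastforce
qed

text \<open>
  A supporting line at \<open>t\<close> with negative slope would force \<open>f\<close> below zero far to the right.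
\<close>

lemma concave_nonneg_mono:
  fixes f :: "real \<Rightarrow> real"
  assumes conc: "concave_on {0..} f" and nonneg: "\<And>x. 0 \<le> x \<Longrightarrow> 0 \<le> f x"
    and "0 \<le> s" "s \<le> t"
  shows "f s \<le> f t"
proof (cases "s = t")
  case False
  then have "0 < t" using assms by simp
  then obtain m where m: "\<And>x. 0 \<le> x \<Longrightarrow> f x \<le> f t + m * (x - t)"
    using concave_supporting_line[OF conc] by blast
  have "m \<ge> 0"
  proof (rule ccontr)
    assume "\<not> m \<ge> 0"
    then have neg: "m < 0" by simp
    \<comment> \<open>The point where the supporting line takes the value \<open>-1\<close>.\<close>
    define x where "x = t + (f t + 1) / - m"
    have "x \<ge> 0" using divide_nonneg_pos[of "f t + 1" "- m"] neg nonneg[of t] \<open>0 < t\<close>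
      by (simp add: x_def)
    moreover have "f t + m * (x - t) = -1" using neg by (simp add: x_def)
    ultimately show False using m[of x] nonneg[of x] by simp
  qed
  then have "m * (s - t) \<le> 0" using \<open>s \<le> t\<close> by (simp add: mult_nonneg_nonpos)
  then show ?thesis using m[OF \<open>0 \<le> s\<close>] by simp
qed simp

text \<open>
  If some term inside \<open>K\<close> is negative, then all terms outside \<open>K\<close> are nonpositive, so the sum over
  \<open>K\<close> is at least the total; otherwise every term in \<open>K\<close> is nonnegative.
\<close>

lemma sum_weighted_upper_set_nonneg:
  fixes p g :: "'n::finite \<Rightarrow> real"
  assumes p: "\<And>j. 0 \<le> p j" and tot: "0 \<le> (\<Sum>j\<in>UNIV. p j * g j)"
    and ord: "\<And>i j. i \<in> K \<Longrightarrow> j \<notin> K \<Longrightarrow> p j \<noteq> 0 \<Longrightarrow> g j \<le> g i"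
  shows "0 \<le> (\<Sum>j\<in>K. p j * g j)"
proof (cases "\<exists>i\<in>K. g i < 0")
  case True
  then obtain i where i: "i \<in> K" "g i < 0" by blast
  have "p j * g j \<le> 0" if "j \<in> - K" for j
  proof (cases "p j = 0")
    case False
    then have "g j \<le> g i" using ord i that by auto
    then show ?thesis using p i by (simp add: mult_nonneg_nonpos)
  qed simp
  then have "(\<Sum>j\<in>-K. p j * g j) \<le> 0" by (rule sum_nonpos)
  moreover have "(\<Sum>j\<in>UNIV. p j * g j) = (\<Sum>j\<in>K. p j * g j) + (\<Sum>j\<in>-K. p j * g j)"
    using sum.subset_diff[of K UNIV "\<lambda>j. p j * g j"] by (simp add: Compl_eq_Diff_UNIV)
  ultimately show ?thesis using tot by simp
next
  case False
  then show ?thesis using p by (intro sum_nonneg mult_nonneg_nonneg) auto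
qed

text \<open>
  This is the scalar core of the argument. Here \<open>a\<close> stands for an eigenvalue of \<open>A\<close>, \<open>c\<close> for the
  spectrum of \<open>A + B\<close>, and \<open>p j\<close> for the squared overlap of the eigenvectors concerned.
  With the line \<open>f(a) + m (t - a)\<close> above \<open>f\<close> and its intercept \<open>\<beta> = f(a) - m a \<ge> f(0) \<ge> 0\<close>,
  concavity gives \<open>f(a) - a f(c\<^sub>j) / c\<^sub>j \<ge> \<beta> (1 - a / c\<^sub>j)\<close>, which replaces \<open>f\<close> by the single
  increasing function \<open>1 - a / c\<close>.
\<close>

lemma concave_weighted_upper_set:
  fixes f :: "real \<Rightarrow> real" and p c :: "'n::finite \<Rightarrow> real"
  assumes conc: "concave_on {0..} f" and nonneg: "\<And>x. 0 \<le> x \<Longrightarrow> 0 \<le> f x"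
    and p: "\<And>j. 0 \<le> p j" "(\<Sum>j\<in>UNIV. p j) = 1"
    and a: "0 \<le> a" and c: "\<And>j. 0 \<le> c j"
    and ker: "\<And>j. c j = 0 \<Longrightarrow> a * p j = 0"
    and harm: "a * (\<Sum>j\<in>UNIV. p j / c j) \<le> 1"
    and K: "\<And>j. j \<in> K \<Longrightarrow> 0 < c j"
    and upper: "\<And>i j. i \<in> K \<Longrightarrow> j \<notin> K \<Longrightarrow> c j \<le> c i"
  shows "(\<Sum>j\<in>K. p j * a * (f (c j) / c j)) \<le> (\<Sum>j\<in>K. p j * f a)"
proof (cases "a = 0")
  case True
  then show ?thesis using p nonneg[of 0] by (simp add: sum_nonneg)
next
  case False
  then have apos: "0 < a" using a by simp
  then obtain m where m: "\<And>t. 0 \<le> t \<Longrightarrow> f t \<le> f a + m * (t - a)"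
    using concave_supporting_line[OF conc] by blast
  define \<beta> where "\<beta> = f a - m * a"
  have \<beta>: "0 \<le> \<beta>" using m[of 0] nonneg[of 0] by (simp add: \<beta>_def)
  have line: "f (c j) / c j \<le> m + \<beta> / c j" if "j \<in> K" for j
    using m[OF c[of j]] K[OF that] by (simp add: \<beta>_def field_simps)
  have "0 \<le> (\<Sum>j\<in>K. p j * (1 - a / c j))"
  proof (rule sum_weighted_upper_set_nonneg[OF p(1)])
    have "(\<Sum>j\<in>UNIV. p j * (1 - a / c j)) = (\<Sum>j\<in>UNIV. p j) - a * (\<Sum>j\<in>UNIV. p j / c j)"
      by (simp add: algebra_simps sum_subtractf sum_distrib_left)
    then show "0 \<le> (\<Sum>j\<in>UNIV. p j * (1 - a / c j))" using p(2) harm by simp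
    show "1 - a / c j \<le> 1 - a / c i" if "i \<in> K" "j \<notin> K" "p j \<noteq> 0" for i j
    proof -
      have "0 < c j" using ker[of j] apos that(3) c[of j] by (cases "c j = 0") auto
      then show ?thesis using upper[OF that(1,2)] apos by (simp add: frac_le)
    qed
  qed
  then have "0 \<le> \<beta> * (\<Sum>j\<in>K. p j * (1 - a / c j))" using \<beta> by simp
  also have "\<dots> = (\<Sum>j\<in>K. p j * (f a - a * (m + \<beta> / c j)))"
    by (simp add: \<beta>_def sum_distrib_left algebra_simps)
  also have "\<dots> \<le> (\<Sum>j\<in>K. p j * (f a - a * (f (c j) / c j)))"
    using p(1) apos line by (intro sum_mono mult_left_mono diff_left_mono) auto
  finally show ?thesis by (simp add: algebra_simps sum_subtractf)
qed

section \<open>Majorization of the spectrum of a sum\<close>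

text \<open>
  The assumption \<open>dom\<close> below is the operator inequality \<open>W\<^sup>* diag(a) W \<le> diag(c)\<close>.
\<close>

context
  fixes W :: "complex ^ 'n ^ 'n" and a c :: "'n \<Rightarrow> real"
  assumes dom: "\<And>x. (\<Sum>l\<in>UNIV. a l * (cmod ((W *v x) $ l))\<^sup>2) \<le> (\<Sum>j\<in>UNIV. c j * (cmod (x $ j))\<^sup>2)"
    and a: "\<And>l. 0 \<le> a l" and c: "\<And>j. 0 \<le> c j"
begin

lemma dominated_kernel:
  assumes "c j = 0"
  shows "a i * (cmod (W $ i $ j))\<^sup>2 = 0"
proof -
  have "a i * (cmod (W $ i $ j))\<^sup>2 \<le> (\<Sum>l\<in>UNIV. a l * (cmod (W $ l $ j))\<^sup>2)"
    using a by (intro member_le_sum) auto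
  \<comment> \<open>Domination is used on the \<open>j\<close>-th unit vector.\<close>
  also have "\<dots> = (\<Sum>l\<in>UNIV. a l * (cmod ((W *v axis j 1) $ l))\<^sup>2)"
    by (simp add: matrix_vector_mult_def axis_def if_distrib[of "\<lambda>x. _ * x"] cong: if_cong)
  also have "\<dots> \<le> (\<Sum>k\<in>UNIV. c k * (cmod (axis j 1 $ k))\<^sup>2)" by (rule dom)
  also have "\<dots> = 0" using assms by (intro sum.neutral) (auto simp: axis_def)
  finally have "a i * (cmod (W $ i $ j))\<^sup>2 \<le> 0" .
  moreover have "0 \<le> a i * (cmod (W $ i $ j))\<^sup>2" using a by simp
  ultimately show ?thesis by (rule order_antisym)
qed

text \<open>
  Put \<open>A = W\<^sup>* diag(a) W\<close> and \<open>C = diag(c)\<close>. For invertible \<open>C\<close> the claim bounds a diagonal entry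
  of \<open>A\<^sup>\<onehalf> C\<^sup>-\<^sup>1 A\<^sup>\<onehalf> \<le> 1\<close> in the eigenbasis of \<open>A\<close>. It is obtained without inverses or square roots by testing the
  operator inequality on \<open>x = diag(c)\<^sup>-\<^sup>1 w\<close>, where \<open>w\<close> is the adjoint of the \<open>i\<close>-th row of \<open>W\<close>. If
  \<open>c\<close> has zeros, the test vector vanishes in the corresponding coordinates, and so do the
  terms of the sum, both by the convention for division by zero.
\<close>

lemma dominated_harmonic:
  "a i * (\<Sum>j\<in>UNIV. (cmod (W $ i $ j))\<^sup>2 / c j) \<le> 1"
proof -
  define q where "q = (\<Sum>j\<in>UNIV. (cmod (W $ i $ j))\<^sup>2 / c j)"
  define x where "x = (\<chi> j. cnj (W $ i $ j) / of_real (c j))"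
  have "q \<ge> 0" using c by (simp add: q_def sum_nonneg)
  have "(W *v x) $ i = of_real q"
    by (simp add: matrix_vector_mult_def x_def q_def complex_norm_square
        del: of_real_power)
  then have "a i * q\<^sup>2 = a i * (cmod ((W *v x) $ i))\<^sup>2" by simp
  also have "\<dots> \<le> (\<Sum>l\<in>UNIV. a l * (cmod ((W *v x) $ l))\<^sup>2)"
    using a by (intro member_le_sum[where f = "\<lambda>l. a l * (cmod ((W *v x) $ l))\<^sup>2"]) auto
  also have "\<dots> \<le> (\<Sum>j\<in>UNIV. c j * (cmod (x $ j))\<^sup>2)" by (rule dom)
  also have "\<dots> = q"
    unfolding q_def by (rule sum.cong) (auto simp: x_def norm_divide power_divide power2_eq_square)
  finally have "(a i * q) * q \<le> 1 * q" by (simp add: power2_eq_square)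
  then show ?thesis
    using \<open>q \<ge> 0\<close> unfolding q_def[symmetric] by (cases "q = 0") auto
qed

text \<open>
  The scalar inequality, applied to each row of \<open>W\<close> (that is, to each eigenvector of
  \<open>W\<^sup>* diag(a) W\<close>) and summed over the rows.
\<close>

lemma dominated_upper_set:
  fixes f :: "real \<Rightarrow> real"
  assumes W: "unitary_matrix W"
    and conc: "concave_on {0..} f" and nonneg: "\<And>x. 0 \<le> x \<Longrightarrow> 0 \<le> f x"
    and K: "\<And>j. j \<in> K \<Longrightarrow> 0 < c j"
    and upper: "\<And>i j. i \<in> K \<Longrightarrow> j \<notin> K \<Longrightarrow> c j \<le> c i"
  shows "(\<Sum>j\<in>K. f (c j) / c j * (\<Sum>i\<in>UNIV. (cmod (W $ i $ j))\<^sup>2 * a i))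
      \<le> (\<Sum>j\<in>K. \<Sum>i\<in>UNIV. (cmod (W $ i $ j))\<^sup>2 * f (a i))"
proof -
  have "(\<Sum>j\<in>K. f (c j) / c j * (\<Sum>i\<in>UNIV. (cmod (W $ i $ j))\<^sup>2 * a i))
      = (\<Sum>i\<in>UNIV. \<Sum>j\<in>K. (cmod (W $ i $ j))\<^sup>2 * a i * (f (c j) / c j))"
    by (subst sum.swap) (simp add: sum_distrib_left mult_ac)
  also have "\<dots> \<le> (\<Sum>i\<in>UNIV. \<Sum>j\<in>K. (cmod (W $ i $ j))\<^sup>2 * f (a i))"
    using a c K upper nonneg unitary_matrix_row_sum[OF W] dominated_kernel dominated_harmonic
    by (intro sum_mono concave_weighted_upper_set[OF conc]) auto
  also have "\<dots> = (\<Sum>j\<in>K. \<Sum>i\<in>UNIV. (cmod (W $ i $ j))\<^sup>2 * f (a i))"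
    by (rule sum.swap)
  finally show ?thesis .
qed

end

text \<open>
  Adding \<open>dominated_upper_set\<close> for the two summands, each of which is dominated by the sum:
  the left-hand sides add up to \<open>f(c\<^sub>j) / c\<^sub>j\<close> times the \<open>j\<close>-th diagonal entry of the sum, which
  is \<open>c\<^sub>j\<close>.
\<close>

lemma concave_sum_weak_majorization:
  fixes W Z :: "complex ^ 'n ^ 'n" and f :: "real \<Rightarrow> real"
  assumes W: "unitary_matrix W" and Z: "unitary_matrix Z"
    and a: "\<And>i. 0 \<le> a i" and b: "\<And>i. 0 \<le> b i"
    and sum: "diag_matrix c = adjoint_matrix W ** diag_matrix a ** W + adjoint_matrix Z ** diag_matrix b ** Z"
    and conc: "concave_on {0..} f" and nonneg: "\<And>x. 0 \<le> x \<Longrightarrow> 0 \<le> f x"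
    and upper: "\<And>i j. i \<in> K \<Longrightarrow> j \<notin> K \<Longrightarrow> c j \<le> c i"
  shows "(\<Sum>j\<in>K. f (c j)) \<le> (\<Sum>j\<in>K. (\<Sum>i\<in>UNIV. (cmod (W $ i $ j))\<^sup>2 * f (a i))
      + (\<Sum>i\<in>UNIV. (cmod (Z $ i $ j))\<^sup>2 * f (b i)))"
    (is "_ \<le> (\<Sum>j\<in>K. ?p j + ?r j)")
proof -
  let ?A = "\<lambda>j. \<Sum>i\<in>UNIV. (cmod (W $ i $ j))\<^sup>2 * a i"
  let ?B = "\<lambda>j. \<Sum>i\<in>UNIV. (cmod (Z $ i $ j))\<^sup>2 * b i"
  have c_eq: "c j = ?A j + ?B j" for j
  proof -
    have "complex_of_real (c j) = diag_matrix c $ j $ j" by (simp add: diag_matrix_def)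
    also have "\<dots> = complex_of_real (?A j + ?B j)"
      unfolding sum by (simp only: vector_add_component conj_diag_diagonal_entry of_real_add)
    finally show ?thesis using of_real_eq_iff by blast
  qed
  have A: "0 \<le> ?A j" and B: "0 \<le> ?B j" for j using a b by (simp_all add: sum_nonneg)
  have c: "0 \<le> c j" for j using c_eq[of j] A[of j] B[of j] by linarith
  have form: "(\<Sum>j\<in>UNIV. c j * (cmod (x $ j))\<^sup>2)
      = (\<Sum>l\<in>UNIV. a l * (cmod ((W *v x) $ l))\<^sup>2) + (\<Sum>l\<in>UNIV. b l * (cmod ((Z *v x) $ l))\<^sup>2)"
    (is "?C = ?QA + ?QB") for x
  proof -
    have id: "adjoint_matrix (mat 1) = (mat 1 :: complex ^ 'n ^ 'n)"
      by (simp add: vec_eq_iff adjoint_matrix_def mat_def)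
    have "complex_of_real ?C = cinner x (diag_matrix c *v x)"
      using cinner_conj_diag[of x "mat 1" c] by (simp add: id)
    also have "\<dots> = complex_of_real (?QA + ?QB)"
      unfolding sum matrix_vector_mult_add_rdistrib cinner_add_right cinner_conj_diag of_real_add ..
    finally show ?thesis using of_real_eq_iff by blast
  qed
  have QA: "0 \<le> (\<Sum>l\<in>UNIV. a l * (cmod ((W *v x) $ l))\<^sup>2)"
    and QB: "0 \<le> (\<Sum>l\<in>UNIV. b l * (cmod ((Z *v x) $ l))\<^sup>2)" for x
    using a b by (simp_all add: sum_nonneg)
  \<comment> \<open>The part of \<open>K\<close> where dividing by \<open>c j\<close> is meaningful; it is again an upper set. The rest,
     where \<open>c j = 0\<close>, only needs \<open>f 0 \<le> f (a i)\<close>.\<close>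
  define K' where "K' = {j \<in> K. 0 < c j}"
  have pos: "\<And>j. j \<in> K' \<Longrightarrow> 0 < c j" by (simp add: K'_def)
  have upper': "c j \<le> c i" if "i \<in> K'" "j \<notin> K'" for i j
    using upper[of i j] that by (force simp: K'_def)
  have "(\<Sum>j\<in>K'. f (c j)) = (\<Sum>j\<in>K'. f (c j) / c j * ?A j) + (\<Sum>j\<in>K'. f (c j) / c j * ?B j)"
    unfolding sum.distrib[symmetric, where A = K'] distrib_left[symmetric] c_eq[symmetric]
    by (rule sum.cong) (simp_all add: K'_def)
  also have "\<dots> \<le> (\<Sum>j\<in>K'. ?p j) + (\<Sum>j\<in>K'. ?r j)"
  proof (rule add_mono)
    show "(\<Sum>j\<in>K'. f (c j) / c j * ?A j) \<le> (\<Sum>j\<in>K'. ?p j)"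
      using form QB by (intro dominated_upper_set[OF _ a c W conc nonneg pos upper']) simp_all
    show "(\<Sum>j\<in>K'. f (c j) / c j * ?B j) \<le> (\<Sum>j\<in>K'. ?r j)"
      using form QA by (intro dominated_upper_set[OF _ b c Z conc nonneg pos upper']) simp_all
  qed
  finally have main: "(\<Sum>j\<in>K'. f (c j)) \<le> (\<Sum>j\<in>K'. ?p j + ?r j)" by (simp add: sum.distrib)
  have "f (c j) \<le> ?p j + ?r j" if "j \<in> K - K'" for j
  proof -
    have "c j = 0" using that c[of j] by (auto simp: K'_def)
    then have "f (c j) = (\<Sum>i\<in>UNIV. (cmod (W $ i $ j))\<^sup>2 * f 0)"
      by (simp add: unitary_matrix_col_sum[OF W] flip: sum_distrib_right)
    also have "\<dots> \<le> ?p j"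
      using a concave_nonneg_mono[OF conc nonneg] by (intro sum_mono mult_left_mono) auto
    finally have "f (c j) \<le> ?p j" .
    moreover have "0 \<le> ?r j" using b nonneg by (intro sum_nonneg) simp
    ultimately show ?thesis by simp
  qed
  then have "(\<Sum>j\<in>K - K'. f (c j)) \<le> (\<Sum>j\<in>K - K'. ?p j + ?r j)" by (rule sum_mono)
  moreover have "K' \<subseteq> K" by (auto simp: K'_def)
  ultimately show ?thesis
    using main sum.subset_diff[of K' K "\<lambda>j. f (c j)"] sum.subset_diff[of K' K "\<lambda>j. ?p j + ?r j"]
    by simp
qed

section \<open>Weak majorization and convex hulls\<close>

text \<open>
  A nonnegative function is a nonnegative combination of the indicators of its level sets (layer
  cake). The induction strips off the layer between zero and the smallest positive value.
\<close>

lemma sum_level_sets_nonneg: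
  fixes w z :: "'n::finite \<Rightarrow> real"
  assumes "\<And>i. 0 \<le> w i"
    and "\<And>t. 0 \<le> t \<Longrightarrow> 0 \<le> (\<Sum>i | t < w i. z i)"
  shows "0 \<le> (\<Sum>i\<in>UNIV. w i * z i)"
  using assms
proof (induction "card {i. 0 < w i}" arbitrary: w rule: less_induct)
  case less
  define S where "S = {i. 0 < w i}"
  show ?case
  proof (cases "S = {}")
    case True
    then have "w i = 0" for i using less.prems(1)[of i] by (simp add: S_def not_less order_antisym)
    then show ?thesis by simp
  next
    case False
    define \<delta> where "\<delta> = Min (w ` S)"
    define v where "v i = (if i \<in> S then w i - \<delta> else 0)" for i
    have \<delta>_le: "\<delta> \<le> w i" if "i \<in> S" for i using that by (simp add: \<delta>_def)
    have "\<delta> \<in> w ` S" unfolding \<delta>_def using False by (intro Min_in) auto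
    then obtain k where k: "k \<in> S" "w k = \<delta>" by auto
    then have \<delta>: "0 < \<delta>" by (auto simp: S_def)
    have "{i. 0 < v i} \<subseteq> S - {k}" using k by (auto simp: v_def split: if_splits)
    then have "card {i. 0 < v i} < card S"
      using k by (metis card_Diff1_less card_mono finite finite_Diff le_less_trans)
    moreover have "0 \<le> v i" for i using \<delta>_le by (simp add: v_def)
    moreover have "0 \<le> (\<Sum>i | t < v i. z i)" if "0 \<le> t" for t
    proof -
      have "t < v i \<longleftrightarrow> t + \<delta> < w i" for i
        using that \<delta> by (auto simp: v_def S_def)
      then show ?thesis using less.prems(2)[of "t + \<delta>"] that \<delta> by simp
    qed
    ultimately have v: "0 \<le> (\<Sum>i\<in>UNIV. v i * z i)"
      using less.hyps[of v] by (simp add: S_def)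
    have w: "w i = v i + \<delta> * (if i \<in> S then 1 else 0)" for i
      using less.prems(1)[of i] by (auto simp: v_def S_def)
    have "(\<Sum>i\<in>UNIV. w i * z i) = (\<Sum>i\<in>UNIV. v i * z i) + \<delta> * (\<Sum>i\<in>UNIV. if i \<in> S then z i else 0)"
      unfolding sum_distrib_left sum.distrib[symmetric]
      by (rule sum.cong) (auto simp: w algebra_simps)
    moreover have "(\<Sum>i\<in>UNIV. if i \<in> S then z i else 0) = (\<Sum>i | 0 < w i. z i)"
      by (simp add: S_def sum.If_cases)
    ultimately show ?thesis using v \<delta> less.prems(2)[of 0] by simp
  qed
qed

text \<open>
  A rearrangement inequality that orders \<open>w \<circ> \<pi>\<close> like \<open>c\<close>, not merely like \<open>y\<close>: the majorization
  is only known for sets that are upper with respect to \<open>c\<close>, and \<open>y = f \<circ> c\<close> may have ties that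
  \<open>c\<close> does not have. Among the permutations that do not decrease the pairing with \<open>y\<close>, one
  maximizing the pairing with \<open>c\<close> has this order, since swapping a badly ordered pair would increase
  the latter without decreasing the former.
\<close>

lemma rearrangement_common_order:
  fixes w y c :: "'n::finite \<Rightarrow> real"
  assumes mono: "\<And>i j. c i \<le> c j \<Longrightarrow> y i \<le> y j"
  obtains \<pi> where "bij \<pi>" "(\<Sum>i\<in>UNIV. w i * y i) \<le> (\<Sum>i\<in>UNIV. w (\<pi> i) * y i)"
    "\<And>i j. w (\<pi> j) < w (\<pi> i) \<Longrightarrow> c j \<le> c i"
proof -
  define S where "S = {\<pi>. bij \<pi> \<and> (\<Sum>i\<in>UNIV. w i * y i) \<le> (\<Sum>i\<in>UNIV. w (\<pi> i) * y i)}"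
  define G where "G \<pi> = (\<Sum>i\<in>UNIV. w (\<pi> i) * c i)" for \<pi> :: "'n \<Rightarrow> 'n"
  have "finite S" by simp
  moreover have "id \<in> S" by (simp add: S_def)
  ultimately obtain \<pi> where \<pi>: "\<pi> \<in> S" "\<And>\<sigma>. \<sigma> \<in> S \<Longrightarrow> G \<sigma> \<le> G \<pi>"
    using finite_subset Max_in[of "G ` S"] Max_ge[of "G ` S"] 
    by (metis (no_types, opaque_lifting) empty_iff finite_imageI image_iff)
  have "c j \<le> c i" if less: "w (\<pi> j) < w (\<pi> i)" for i j
  proof (rule ccontr)
    assume "\<not> c j \<le> c i"
    then have cij: "c i < c j" by simp
    have ij: "i \<noteq> j" using less by auto
    define \<sigma> where "\<sigma> = \<pi> \<circ> Transposition.transpose i j"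
    have diff: "(\<Sum>k\<in>UNIV. w (\<sigma> k) * x k) - (\<Sum>k\<in>UNIV. w (\<pi> k) * x k)
        = (w (\<pi> i) - w (\<pi> j)) * (x j - x i)" for x
    proof -
      have "(\<Sum>k\<in>UNIV. w (\<sigma> k) * x k) - (\<Sum>k\<in>UNIV. w (\<pi> k) * x k)
          = (\<Sum>k\<in>UNIV. (w (\<sigma> k) - w (\<pi> k)) * x k)"
        by (simp add: sum_subtractf algebra_simps)
      also have "\<dots> = (\<Sum>k\<in>{i, j}. (w (\<sigma> k) - w (\<pi> k)) * x k)"
        by (rule sum.mono_neutral_right) (auto simp: \<sigma>_def transpose_def)
      also have "\<dots> = (w (\<pi> i) - w (\<pi> j)) * (x j - x i)"
        using ij by (simp add: \<sigma>_def transpose_def algebra_simps)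
      finally show ?thesis .
    qed
    have "0 \<le> (w (\<pi> i) - w (\<pi> j)) * (y j - y i)"
      using less cij mono[of i j] by simp
    moreover have "bij \<sigma>"
      using \<pi>(1) by (auto simp: S_def \<sigma>_def intro: bij_comp)
    ultimately have "\<sigma> \<in> S" using \<pi>(1) diff[of y] by (simp add: S_def)
    then have "G \<sigma> \<le> G \<pi>" by (rule \<pi>(2))
    moreover have "0 < (w (\<pi> i) - w (\<pi> j)) * (c j - c i)" using less cij by simp
    ultimately show False using diff[of c] by (simp add: G_def)
  qed
  then show thesis using \<pi>(1) that by (auto simp: S_def)
qed

text \<open>
  Otherwise a linear functional \<open>w\<close> would be larger at \<open>y\<close> than at every signed permutation of \<open>m\<close>.
  By rearrangement one may replace \<open>w\<close> by \<open>|w|\<close> ordered like \<open>c\<close>. The level sets of the latter are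
  upper sets, so the majorization, summed over level sets, bounds its pairing with \<open>y\<close> by its
  pairing with \<open>m\<close>, and this is the value of \<open>w\<close> at a signed permutation of \<open>m\<close>.
\<close>

lemma weakly_majorized_in_convex_hull:
  fixes y m c :: "'n::finite \<Rightarrow> real"
  assumes y: "\<And>i. 0 \<le> y i" and mono: "\<And>i j. c i \<le> c j \<Longrightarrow> y i \<le> y j"
    and maj: "\<And>K. (\<And>i j. i \<in> K \<Longrightarrow> j \<notin> K \<Longrightarrow> c j \<le> c i) \<Longrightarrow> (\<Sum>i\<in>K. y i) \<le> (\<Sum>i\<in>K. m i)"
  shows "(\<chi> i. y i) \<in> convex hull {\<chi> i. s i * m (\<pi> i) | s \<pi>. bij \<pi> \<and> (\<forall>i. \<bar>s i\<bar> = (1::real))}"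
    (is "_ \<in> convex hull ?G")
proof (rule ccontr)
  assume notin: "(\<chi> i. y i) \<notin> convex hull ?G"
  \<comment> \<open>The orbit \<open>?G\<close> is finite, so its convex hull is closed and can be separated from \<open>y\<close>.\<close>
  have "?G \<subseteq> (\<lambda>(\<pi>, s). \<chi> i. (if s i then 1 else -1) * m (\<pi> i)) ` (UNIV :: (('n \<Rightarrow> 'n) \<times> ('n \<Rightarrow> bool)) set)"
  proof clarify
    fix s :: "'n \<Rightarrow> real" and \<pi> :: "'n \<Rightarrow> 'n"
    assume "\<forall>i. \<bar>s i\<bar> = 1"
    then have "s i = (if 0 < s i then 1 else -1)" for i
      by (metis abs_of_nonneg abs_of_nonpos less_eq_real_def minus_equation_iff not_less)
    then show "(\<chi> i. s i * m (\<pi> i)) \<in> range (\<lambda>(\<pi>, s). \<chi> i. (if s i then 1 else -1) * m (\<pi> i))"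
      by (intro image_eqI[of _ _ "(\<pi>, \<lambda>i. 0 < s i)"]) (auto simp: vec_eq_iff)
  qed
  then have "finite ?G" by (rule finite_subset) simp
  then have "closed (convex hull ?G)"
    by (intro compact_imp_closed finite_imp_compact_convex_hull)
  then obtain a b where a: "inner a (\<chi> i. y i) < b" "\<And>x. x \<in> convex hull ?G \<Longrightarrow> b < inner a x"
    using separating_hyperplane_closed_point[OF convex_convex_hull _ notin] by blast
  define w where "w i = \<bar>a $ i\<bar>" for i
  obtain \<pi> where \<pi>: "bij \<pi>" "(\<Sum>i\<in>UNIV. w i * y i) \<le> (\<Sum>i\<in>UNIV. w (\<pi> i) * y i)"
    "\<And>i j. w (\<pi> j) < w (\<pi> i) \<Longrightarrow> c j \<le> c i"
    using rearrangement_common_order[of c y w] mono by blast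
  have "0 \<le> (\<Sum>i\<in>UNIV. w (\<pi> i) * (m i - y i))"
  proof (rule sum_level_sets_nonneg)
    show "0 \<le> (\<Sum>i | t < w (\<pi> i). m i - y i)" for t
    proof -
      have "(\<Sum>i | t < w (\<pi> i). y i) \<le> (\<Sum>i | t < w (\<pi> i). m i)"
        by (rule maj) (rule \<pi>(3), auto)
      then show ?thesis by (simp add: sum_subtractf)
    qed
  qed (simp add: w_def)
  then have "(\<Sum>i\<in>UNIV. w (\<pi> i) * y i) \<le> (\<Sum>i\<in>UNIV. w (\<pi> i) * m i)"
    by (simp add: algebra_simps sum_subtractf)
  also have "\<dots> = (\<Sum>i\<in>UNIV. w i * m (inv \<pi> i))"
    using \<pi>(1) by (intro sum.reindex_bij_witness[of _ "inv \<pi>" \<pi>])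
      (auto simp: bij_is_inj bij_is_surj surj_f_inv_f)
  finally have le: "(\<Sum>i\<in>UNIV. w i * y i) \<le> (\<Sum>i\<in>UNIV. w i * m (inv \<pi> i))"
    using \<pi>(2) by simp
  \<comment> \<open>The separating functional \<open>a\<close> is smaller at \<open>y\<close> than on the hull; the signs are chosen so that
     \<open>a $ i * s i = - w i\<close>.\<close>
  define s where "s i = (if 0 \<le> a $ i then - 1 else 1 :: real)" for i
  have "(\<chi> i. s i * m (inv \<pi> i)) \<in> convex hull ?G"
    using \<pi>(1) by (intro hull_inc CollectI exI[of _ s] exI[of _ "inv \<pi>"])
      (simp add: s_def bij_imp_bij_inv)
  then have "b < (\<Sum>i\<in>UNIV. a $ i * (s i * m (inv \<pi> i)))"
    using a(2) by (force simp: inner_vec_def)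
  also have "\<dots> = - (\<Sum>i\<in>UNIV. w i * m (inv \<pi> i))"
    unfolding sum_negf[symmetric] by (rule sum.cong) (auto simp: w_def s_def)
  also have "\<dots> \<le> (\<Sum>i\<in>UNIV. - (w i * y i))"
    using le by (simp add: sum_negf)
  also have "\<dots> \<le> (\<Sum>i\<in>UNIV. a $ i * y i)"
  proof (rule sum_mono)
    fix i
    have "- w i * y i \<le> a $ i * y i" using y by (intro mult_right_mono) (simp_all add: w_def)
    then show "- (w i * y i) \<le> a $ i * y i" by simp
  qed
  also have "\<dots> < b" using a(1) by (simp add: inner_vec_def)
  finally show False .
qed

section \<open>Symmetric norms\<close>

lemma unitary_diag_signs:
  assumes "\<And>i. \<bar>s i\<bar> = 1"
  shows "unitary_matrix (diag_matrix s)"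
proof (rule unitary_matrix_adjointI)
  have "s i * s i = 1" for i using assms[of i] by (metis abs_mult_self_eq mult_1)
  then have "complex_of_real (s i) * complex_of_real (s i) = 1" for i
    by (metis of_real_1 of_real_mult)
  then show "adjoint_matrix (diag_matrix s) ** diag_matrix s = mat 1"
    by (simp add: vec_eq_iff diag_matrix_mult_left) (simp add: diag_matrix_def mat_def)
qed

lemma symmetric_norm_unitary:
  assumes "symmetric_norm N" "unitary_matrix U" "unitary_matrix V"
  shows "N (U ** X ** V) = N X"
  using assms by (simp add: symmetric_norm_def)

lemma symmetric_norm_convex:
  assumes "symmetric_norm N" "0 \<le> u" "0 \<le> v"
  shows "N (\<chi> i j. of_real u * X $ i $ j + of_real v * Y $ i $ j) \<le> u * N X + v * N Y"
proof -
  have tri: "N (X + Y) \<le> N X + N Y" for X Y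
    using assms(1) by (simp add: symmetric_norm_def matrix_norm_def)
  have scale: "N (\<chi> i j. z * X $ i $ j) = cmod z * N X" for z X
    using assms(1) by (simp add: symmetric_norm_def matrix_norm_def)
  have "(\<chi> i j. of_real u * X $ i $ j + of_real v * Y $ i $ j)
      = (\<chi> i j. of_real u * X $ i $ j) + (\<chi> i j. of_real v * Y $ i $ j)"
    by (simp add: vec_eq_iff)
  then have "N (\<chi> i j. of_real u * X $ i $ j + of_real v * Y $ i $ j)
      \<le> N (\<chi> i j. of_real u * X $ i $ j) + N (\<chi> i j. of_real v * Y $ i $ j)"
    using tri by simp
  also have "\<dots> = u * N X + v * N Y"
    using scale assms(2,3) by (simp only: norm_of_real abs_of_nonneg)
  finally show ?thesis .
qed

text \<open>
  Averaging \<open>M\<close> with \<open>D M D\<close>, where \<open>D\<close> flips the sign of the single coordinate \<open>k\<close>, deletes the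
  off-diagonal entries of row and column \<open>k\<close> and keeps everything else.
\<close>

lemma symmetric_norm_partial_pinching:
  fixes M :: "complex ^ 'n ^ 'n"
  assumes N: "symmetric_norm N" and "finite S"
  shows "N (\<chi> i j. if i \<noteq> j \<and> (i \<in> S \<or> j \<in> S) then 0 else M $ i $ j) \<le> N M"
  using \<open>finite S\<close>
proof (induction S)
  case empty
  have "(\<chi> i j. M $ i $ j) = M" by (simp add: vec_eq_iff)
  then show ?case by simp
next
  case (insert k S)
  define P where "P = (\<chi> i j. if i \<noteq> j \<and> (i \<in> S \<or> j \<in> S) then 0 else M $ i $ j)"
  define D :: "complex ^ 'n ^ 'n" where "D = diag_matrix (\<lambda>i. if i = k then -1 else 1)"
  have "unitary_matrix D" unfolding D_def by (rule unitary_diag_signs) simp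
  then have NP: "N (D ** P ** D) = N P" using N symmetric_norm_unitary by blast
  have "(\<chi> i j. if i \<noteq> j \<and> (i \<in> insert k S \<or> j \<in> insert k S) then 0 else M $ i $ j)
      = (\<chi> i j. of_real (1/2) * P $ i $ j + of_real (1/2) * (D ** P ** D) $ i $ j)"
    by (simp add: vec_eq_iff D_def diag_matrix_mult_left diag_matrix_mult_right P_def)
  then have "N (\<chi> i j. if i \<noteq> j \<and> (i \<in> insert k S \<or> j \<in> insert k S) then 0 else M $ i $ j)
      \<le> 1/2 * N P + 1/2 * N (D ** P ** D)"
    using symmetric_norm_convex[OF N, of "1/2" "1/2" P "D ** P ** D"] by simp
  also have "\<dots> = N P" using NP by simp
  finally show ?case using insert.IH by (simp add: P_def)
qed

lemma symmetric_norm_pinching: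
  assumes "symmetric_norm N" and diag: "\<And>j. M $ j $ j = complex_of_real (m j)"
  shows "N (diag_matrix m) \<le> N M"
proof -
  have "diag_matrix m = (\<chi> i j. if i \<noteq> j \<and> (i \<in> UNIV \<or> j \<in> UNIV) then 0 else M $ i $ j)"
    by (simp add: vec_eq_iff diag_matrix_def diag)
  then show ?thesis using symmetric_norm_partial_pinching[OF assms(1), of UNIV M] by simp
qed

text \<open>
  Permuting and flipping the signs of diagonal entries is multiplication by signed permutation
  matrices, which are unitary.
\<close>

lemma symmetric_norm_diag_signed_permutation:
  fixes x :: "'n::finite \<Rightarrow> real"
  assumes N: "symmetric_norm N" and \<pi>: "bij \<pi>" and s: "\<And>i. \<bar>s i\<bar> = 1"
  shows "N (diag_matrix (\<lambda>i. s i * x (\<pi> i))) = N (diag_matrix x)"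
proof -
  define P :: "complex ^ 'n ^ 'n" where "P = (\<chi> i j. if j = \<pi> i then 1 else 0)"
  have inj: "\<pi> i = \<pi> j \<longleftrightarrow> i = j" for i j using \<pi> by (auto dest: bij_is_inj injD)
  have "P ** adjoint_matrix P = mat 1"
    by (simp add: vec_eq_iff P_def adjoint_matrix_def matrix_matrix_mult_def mat_def inj
        if_distrib[of cnj] if_distrib[of "\<lambda>x. x * _"] cong: if_cong)
  then have "unitary_matrix (adjoint_matrix P)" by (intro unitary_matrix_adjointI) simp
  then have P: "unitary_matrix P" using unitary_matrix_adjoint by fastforce
  have "(P ** diag_matrix x ** adjoint_matrix P) $ i $ j
      = (\<Sum>k\<in>UNIV. if k = \<pi> i then complex_of_real (x k) * cnj (P $ j $ k) else 0)" for i j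
    unfolding matrix_matrix_mult_def[of "P ** diag_matrix x"]
    by (simp only: vec_lambda_beta diag_matrix_mult_right adjoint_matrix_def)
       (rule sum.cong, auto simp: P_def)
  then have "P ** diag_matrix x ** adjoint_matrix P = diag_matrix (\<lambda>i. x (\<pi> i))"
    by (simp add: vec_eq_iff diag_matrix_def P_def inj) 
  moreover have "diag_matrix s ** diag_matrix (\<lambda>i. x (\<pi> i)) = diag_matrix (\<lambda>i. s i * x (\<pi> i))"
    by (simp add: vec_eq_iff diag_matrix_mult_left) (simp add: diag_matrix_def)
  ultimately have "diag_matrix (\<lambda>i. s i * x (\<pi> i))
      = (diag_matrix s ** P) ** diag_matrix x ** adjoint_matrix P"
    by (metis matrix_mul_assoc)
  then show ?thesis
    using N P s by (simp add: symmetric_norm_unitary unitary_matrix_mult unitary_diag_signs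
        unitary_matrix_adjoint)
qed

lemma convex_on_symmetric_norm_diag:
  fixes N :: "complex ^ 'n ^ 'n \<Rightarrow> real"
  assumes "symmetric_norm N"
  shows "convex_on UNIV (\<lambda>v :: real ^ 'n. N (diag_matrix (\<lambda>i. v $ i)))"
proof (rule convex_onI)
  fix t :: real and x y :: "real ^ 'n"
  assume t: "0 < t" "t < 1"
  have "diag_matrix (\<lambda>i. ((1 - t) *\<^sub>R x + t *\<^sub>R y) $ i)
      = (\<chi> i j. of_real (1 - t) * diag_matrix (\<lambda>i. x $ i) $ i $ j
              + of_real t * diag_matrix (\<lambda>i. y $ i) $ i $ j)"
    by (simp add: vec_eq_iff diag_matrix_def)
  then show "N (diag_matrix (\<lambda>i. ((1 - t) *\<^sub>R x + t *\<^sub>R y) $ i))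
      \<le> (1 - t) * N (diag_matrix (\<lambda>i. x $ i)) + t * N (diag_matrix (\<lambda>i. y $ i))"
    using symmetric_norm_convex[OF assms, of "1 - t" t "diag_matrix (\<lambda>i. x $ i)" "diag_matrix (\<lambda>i. y $ i)"] t
    by (simp only: diff_ge_0_iff_ge less_imp_le)
qed simp

text \<open>
  A convex function is bounded on a convex hull by its bound on the generating set, and the norm is
  constant on the signed permutations of \<open>m\<close>.
\<close>

lemma symmetric_norm_diag_weak_majorization:
  fixes y m c :: "'n::finite \<Rightarrow> real"
  assumes N: "symmetric_norm N"
    and y: "\<And>i. 0 \<le> y i" and mono: "\<And>i j. c i \<le> c j \<Longrightarrow> y i \<le> y j"
    and maj: "\<And>K. (\<And>i j. i \<in> K \<Longrightarrow> j \<notin> K \<Longrightarrow> c j \<le> c i) \<Longrightarrow> (\<Sum>i\<in>K. y i) \<le> (\<Sum>i\<in>K. m i)"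
  shows "N (diag_matrix y) \<le> N (diag_matrix m)"
proof -
  let ?G = "{\<chi> i. s i * m (\<pi> i) | s \<pi>. bij \<pi> \<and> (\<forall>i. \<bar>s i\<bar> = (1::real))}"
  have "(\<chi> i. y i) \<in> convex hull ?G"
    using weakly_majorized_in_convex_hull[of y c m] y mono maj by blast
  moreover have "\<forall>v\<in>?G. N (diag_matrix (\<lambda>i. v $ i)) \<le> N (diag_matrix m)"
  proof clarify
    fix s :: "'n \<Rightarrow> real" and \<pi> :: "'n \<Rightarrow> 'n"
    assume "bij \<pi>" "\<forall>i. \<bar>s i\<bar> = 1"
    then show "N (diag_matrix (\<lambda>i. (\<chi> i. s i * m (\<pi> i)) $ i)) \<le> N (diag_matrix m)"
      using symmetric_norm_diag_signed_permutation[OF N, of \<pi> s m] by (simp only: vec_lambda_beta order_refl)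
  qed
  moreover have "convex_on (convex hull ?G) (\<lambda>v. N (diag_matrix (\<lambda>i. v $ i)))"
    using convex_on_symmetric_norm_diag[OF N] by (rule convex_on_subset) auto
  ultimately have "N (diag_matrix (\<lambda>i. (\<chi> i. y i) $ i)) \<le> N (diag_matrix m)"
    using convex_on_convex_hull_bound by blast
  then show ?thesis by (simp only: vec_lambda_beta)
qed

section \<open>Subadditivity of concave functions under symmetric norms\<close>

theorem theorem1p1:
  fixes A B :: "complex ^ 'n ^ 'n"
    and f :: "real \<Rightarrow> real"
    and N :: "complex ^ 'n ^ 'n \<Rightarrow> real"
  assumes "positive_semidefinite A"
    and "positive_semidefinite B"
    and "concave_on {0..} f"
    and "\<And>x. 0 \<le> x \<Longrightarrow> 0 \<le> f x"
    and "symmetric_norm N"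
  shows "N (matrix_fun f (A + B)) \<le> N (matrix_fun f A + matrix_fun f B)"
proof -
  note conc = assms(3) and nonneg = assms(4) and N = assms(5)
  have psd: "positive_semidefinite (A + B)" using assms(1,2) by (rule positive_semidefinite_add)
  obtain U a where Ua: "spectral_decomposition A U a"
    using hermitian_spectral_decomposition assms(1) positive_semidefinite_def by blast
  obtain V b where Vb: "spectral_decomposition B V b"
    using hermitian_spectral_decomposition assms(2) positive_semidefinite_def by blast
  obtain X c where Xc: "spectral_decomposition (A + B) X c"
    using hermitian_spectral_decomposition psd positive_semidefinite_def by blast
  have a: "0 \<le> a i" and b: "0 \<le> b i" and c: "0 \<le> c i" for i
    using positive_semidefinite_eigenvalue_nonneg assms(1,2) psd Ua Vb Xc by blast+
  have X: "unitary_matrix X" and U: "unitary_matrix U" and V: "unitary_matrix V"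
    using Ua Vb Xc by (simp_all add: spectral_decomposition_def)
  have X': "adjoint_matrix X ** X = mat 1" using X by (simp add: unitary_matrix_def)
  \<comment> \<open>The unitaries \<open>W\<close> and \<open>Z\<close> express the eigenbases of \<open>A\<close> and \<open>B\<close> in that of \<open>A + B\<close>.\<close>
  define W where "W = adjoint_matrix U ** X"
  define Z where "Z = adjoint_matrix V ** X"
  have W: "unitary_matrix W" and Z: "unitary_matrix Z"
    using X U V by (simp_all add: W_def Z_def unitary_matrix_mult unitary_matrix_adjoint)
  have conjW: "adjoint_matrix X ** (U ** D ** adjoint_matrix U) ** X = adjoint_matrix W ** D ** W"
    and conjZ: "adjoint_matrix X ** (V ** D ** adjoint_matrix V) ** X = adjoint_matrix Z ** D ** Z" for D
    by (simp_all add: W_def Z_def adjoint_matrix_mult matrix_mul_assoc)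
  have "diag_matrix c = adjoint_matrix X ** (X ** diag_matrix c ** adjoint_matrix X) ** X"
    using X' by (metis matrix_mul_assoc matrix_mul_lid matrix_mul_rid)
  also have "\<dots> = adjoint_matrix X ** (A + B) ** X"
    using Xc by (simp add: spectral_decomposition_def)
  also have "\<dots> = adjoint_matrix X ** A ** X + adjoint_matrix X ** B ** X"
    by (simp add: matrix_add_ldistrib matrix_mult_add_rdistrib)
  also have "\<dots> = adjoint_matrix W ** diag_matrix a ** W + adjoint_matrix Z ** diag_matrix b ** Z"
    using Ua Vb conjW conjZ by (simp add: spectral_decomposition_def)
  finally have sum: "diag_matrix c
      = adjoint_matrix W ** diag_matrix a ** W + adjoint_matrix Z ** diag_matrix b ** Z" .
  \<comment> \<open>The matrix \<open>f(A) + f(B)\<close> in the eigenbasis of \<open>A + B\<close>, and its diagonal.\<close>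
  define M where "M = adjoint_matrix W ** diag_matrix (\<lambda>i. f (a i)) ** W
      + adjoint_matrix Z ** diag_matrix (\<lambda>i. f (b i)) ** Z"
  define m where "m j = (\<Sum>i\<in>UNIV. (cmod (W $ i $ j))\<^sup>2 * f (a i))
      + (\<Sum>i\<in>UNIV. (cmod (Z $ i $ j))\<^sup>2 * f (b i))" for j
  have "N (matrix_fun f (A + B)) = N (diag_matrix (\<lambda>i. f (c i)))"
    using X by (simp add: matrix_fun_eq[OF Xc] symmetric_norm_unitary[OF N] unitary_matrix_adjoint)
  also have "\<dots> \<le> N (diag_matrix m)"
  proof (rule symmetric_norm_diag_weak_majorization[OF N, where c = c])
    show "0 \<le> f (c i)" for i using nonneg c .
    show "f (c i) \<le> f (c j)" if "c i \<le> c j" for i j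
      using concave_nonneg_mono[OF conc nonneg c that] .
    show "(\<Sum>j\<in>K. f (c j)) \<le> (\<Sum>j\<in>K. m j)"
      if "\<And>i j. i \<in> K \<Longrightarrow> j \<notin> K \<Longrightarrow> c j \<le> c i" for K
      unfolding m_def by (rule concave_sum_weak_majorization[OF W Z a b sum conc nonneg that])
  qed
  also have "\<dots> \<le> N M"
    by (rule symmetric_norm_pinching[OF N])
      (simp only: M_def m_def vector_add_component conj_diag_diagonal_entry of_real_add)
  also have "M = adjoint_matrix X ** (matrix_fun f A + matrix_fun f B) ** X"
    by (simp add: M_def matrix_fun_eq[OF Ua] matrix_fun_eq[OF Vb] matrix_add_ldistrib
        matrix_mult_add_rdistrib flip: conjW conjZ)
  also have "N \<dots> = N (matrix_fun f A + matrix_fun f B)"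
    using X by (simp add: symmetric_norm_unitary[OF N] unitary_matrix_adjoint)
  finally show ?thesis .
qed

end
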